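(* Let $q$ be a prime power, $m\ge1$ an integer, $n=q^m-1$, and let $\alpha$ be a primitive $n$-th root of unity over $\mathbb{F}_q$. Let $C$ and $D$ be cyclic codes of length $n$ over $\mathbb{F}_q$. Let $\{i_1,\ldots,i_t\}$ be the set of all leaders of $q$-cyclotomic cosets modulo $n$, and $T=\{\alpha^{i_j}: 1\le j\le t\}$. Then the pair $(C,D)$ is an LCP of codes if and only if $\mathrm{BZ}(C^\perp)=T\setminus \mathrm{BZ}(D^\perp)$.
   Context: A linear code of length $n$ over $\mathbb{F}_q$ is a subspace of $\mathbb{F}_q^n$; $C^\perp$ denotes its dual under the Euclidean inner product. A pair $(C,D)$ of linear codes of length $n$ over $\mathbb{F}_q$ is a linear complementary pair (LCP) if $C\oplus D=\mathbb{F}_q^n$. A linear code is cyclic if it is closed under cyclic shifts; identifying $(c_0,\ldots,c_{n-1})$ with $\sum c_ix^i$, a cyclic code is an ideal of $\mathbb{F}_q[x]/(x^n-1)$, and its generator polynomial is the unique monic divisor $g(x)$ of $x^n-1$ generating it (for the zero code, $g(x)=x^n-1$). The dual of a cyclic code is cyclic. The $q$-cyclotomic coset of an integer $a$ modulo $n$ is $B_a=\{a,aq,\ldots,aq^{\delta_a-1}\}\subseteq\mathbb{Z}_n$ (reduced mod $n$), where $\delta_a=|B_a|$ is the smallest positive integer with $aq^{\delta_a}\equiv a \pmod n$. These cosets partition $\mathbb{Z}_n$; a set of coset leaders contains exactly one representative of each coset. For an integer $i$, $m_{\alpha^i}(x)=\prod_{s\in B_i}(x-\alpha^s)$ is the minimal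 polynomial of $\alpha^i$ over $\mathbb{F}_q$. If $E$ is a cyclic code of length $n$ whose generator polynomial is $\prod_{j\in S}m_{\alpha^{i_j}}(x)$ with $S\subseteq\{1,\ldots,t\}$, then $\mathrm{BZ}(E)=\{\alpha^{i_j}: j\in S\}$; thus $\mathrm{BZ}(C^\perp)$ (the basic dual zero of $C$) is computed from the generator polynomial of $C^\perp$, and likewise $\mathrm{BZ}(D^\perp)$. *)

theory Defs
  imports "Jordan_Normal_Form.VS_Connect" "Jordan_Normal_Form.Char_Poly" "HOL-Number_Theory.Residues" "HOL-Library.Cardinality"
begin

definition linear_code :: "nat \<Rightarrow> 'a::field vec set \<Rightarrow> bool" where
  "linear_code n C \<longleftrightarrow> VectorSpace.subspace class_ring C (module_vec TYPE('a) n)"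

definition dual_code :: "nat \<Rightarrow> 'a::field vec set \<Rightarrow> 'a vec set" where
  "dual_code n C = vec_module.orthogonal_complement n C"

definition LCP :: "nat \<Rightarrow> 'a::field vec set \<Rightarrow> 'a vec set \<Rightarrow> bool" where
  "LCP n C D \<longleftrightarrow> linear_code n C \<and> linear_code n D \<and>
     {c + d |c d. c \<in> C \<and> d \<in> D} = carrier_vec n \<and> C \<inter> D = {0\<^sub>v n}"

text \<open>The shift sends \<open>(c\<^sub>0, \<dots>, c\<^bsub>n-1\<^esub>)\<close> to \<open>(c\<^bsub>n-1\<^esub>, c\<^sub>0, \<dots>, c\<^bsub>n-2\<^esub>)\<close>.\<close>

definition cyclic_shift :: "nat \<Rightarrow> 'a vec \<Rightarrow> 'a vec" where
  "cyclic_shift n c = vec n (\<lambda>i. c $ ((i + n - 1) mod n))"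

definition cyclic_code :: "nat \<Rightarrow> 'a::field vec set \<Rightarrow> bool" where
  "cyclic_code n C \<longleftrightarrow> linear_code n C \<and> (\<forall>c\<in>C. cyclic_shift n c \<in> C)"

definition code_poly :: "nat \<Rightarrow> 'a::field vec \<Rightarrow> 'a poly" where
  "code_poly n c = (\<Sum>i<n. Polynomial.monom (c $ i) i)"

text \<open>An element of \<open>F[x]/(x\<^sup>n - 1)\<close> is represented by its remainder modulo \<open>x\<^sup>n - 1\<close>, so that
  the set of remainders of all multiples of \<open>g\<close> is the ideal generated by \<open>g\<close> in the quotient.\<close>

definition generator_poly :: "nat \<Rightarrow> 'a::field vec set \<Rightarrow> 'a poly" where
  "generator_poly n C = (THE g. monic g \<and> g dvd Polynomial.monom 1 n - 1 \<and>
     code_poly n ` C = {(f * g) mod (Polynomial.monom 1 n - 1) |f. True})"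

definition coset_size :: "nat \<Rightarrow> nat \<Rightarrow> nat \<Rightarrow> nat" where
  "coset_size q n a = (LEAST d. 0 < d \<and> [a * q ^ d = a] (mod n))"

definition cyclotomic_coset :: "nat \<Rightarrow> nat \<Rightarrow> nat \<Rightarrow> nat set" where
  "cyclotomic_coset q n a = (\<lambda>k. a * q ^ k mod n) ` {..<coset_size q n a}"

definition coset_leaders :: "nat \<Rightarrow> nat \<Rightarrow> nat set \<Rightarrow> bool" where
  "coset_leaders q n L \<longleftrightarrow> L \<subseteq> {..<n} \<and> (\<forall>a<n. \<exists>!i. i \<in> L \<and> i \<in> cyclotomic_coset q n a)"

definition primitive_root_of_unity :: "nat \<Rightarrow> 'k::field \<Rightarrow> bool" where
  "primitive_root_of_unity n \<alpha> \<longleftrightarrow> \<alpha> ^ n = 1 \<and> (\<forall>k. 0 < k \<and> k < n \<longrightarrow> \<alpha> ^ k \<noteq> 1)"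

definition coset_min_poly :: "nat \<Rightarrow> nat \<Rightarrow> 'k::field \<Rightarrow> nat \<Rightarrow> 'k poly" where
  "coset_min_poly q n \<alpha> i = (\<Prod>s\<in>cyclotomic_coset q n i. [:- (\<alpha> ^ s), 1:])"

text \<open>The product over a coset is the image under \<open>\<iota>\<close> of the minimal polynomial of \<open>\<alpha> ^ i\<close>.\<close>

context
  fixes \<iota> :: "'a::{field,finite} \<Rightarrow> 'k::field" and \<alpha> :: 'k and q n :: nat
  assumes hom: "field_hom \<iota>" and q: "q = CARD('a)"
    and \<alpha>: "primitive_root_of_unity n \<alpha>" and n: "0 < n" and qn: "coprime q n"
begin

interpretation field_hom \<iota> by (rule hom)

private lemma q1: "q > 1"
proof -
  have "card {0, 1::'a} \<le> card (UNIV :: 'a set)" by (rule card_mono) auto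
  then show ?thesis by (simp add: q)
qed

private lemma power_q: "a ^ q = (a::'a)"
proof (cases "a = 0")
  case True
  then show ?thesis using q1 by simp
next
  case False
  let ?U = "UNIV - {0::'a}"
  have "bij_betw ((*) a) ?U ?U"
    by (rule bij_betwI[where g = "\<lambda>x. x / a"]) (use False in auto)
  then have "(\<Prod>x\<in>?U. a * x) = \<Prod>?U" by (rule prod.reindex_bij_betw)
  then have "a ^ card ?U * \<Prod>?U = \<Prod>?U" by (simp add: prod.distrib)
  then have "a ^ card ?U = 1" by (simp add: prod_zero_iff)
  moreover have "q = Suc (card ?U)" using q1 by (simp add: q card_Diff_singleton)
  ultimately show ?thesis by (simp only: power_Suc mult_1_right)
qed

private lemma add_power_q: "(x + y) ^ q = x ^ q + (y::'k) ^ q"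
proof -
  let ?P = "[:1, 1::'a:] ^ q" let ?Q = "Polynomial.monom 1 q + 1 :: 'a poly"
  have eq: "?P = ?Q"
  proof (rule ccontr)
    assume "?P \<noteq> ?Q"
    then have ne: "?P - ?Q \<noteq> 0" by simp
    have dP: "degree ?P = q" by (simp add: degree_power_eq)
    have lP: "Polynomial.coeff ?P q = 1"
      using monic_power[of "[:1, 1::'a:]" q] dP by simp
    have "degree ?Q \<le> q" by (intro degree_add_le) (auto simp: degree_monom_le)
    then have "degree (?P - ?Q) \<le> q" using dP by (simp add: degree_diff_le)
    moreover have "Polynomial.coeff (?P - ?Q) q = 0" using lP q1 by (simp add: coeff_1)
    ultimately have "degree (?P - ?Q) < q" using ne by (metis le_neq_implies_less leading_coeff_0_iff)
    moreover have "{x. poly (?P - ?Q) x = 0} = UNIV"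
      by (auto simp: poly_monom power_q)
    then have "q \<le> degree (?P - ?Q)"
      using card_poly_roots_bound[OF ne] by (simp add: q)
    ultimately show False by simp
  qed
  interpret P: map_poly_comm_ring_hom \<iota> ..
  have "map_poly \<iota> ?P = map_poly \<iota> ?Q" by (simp only: eq)
  then have E: "[:1, 1::'k:] ^ q = Polynomial.monom 1 q + 1"
    by (simp add: hom_distribs)
  have one: "(1 + z) ^ q = z ^ q + (1::'k)" for z
    using arg_cong[OF E, of "\<lambda>p. poly p z"] by (simp add: poly_monom)
  show ?thesis
  proof (cases "y = 0")
    case True
    then show ?thesis using q1 by simp
  next
    case False
    then have "x + y = y * (1 + x / y)" by (simp add: distrib_left)
    then have "(x + y) ^ q = (y * (1 + x / y)) ^ q" by (rule arg_cong)
    also have "\<dots> = y ^ q * (x / y) ^ q + y ^ q"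
      by (subst power_mult_distrib) (simp only: one distrib_left mult_1_right)
    also have "\<dots> = x ^ q + y ^ q" using False by (simp add: power_divide)
    finally show ?thesis .
  qed
qed

private lemma frob: "field_hom (\<lambda>x::'k. x ^ q)"
  by unfold_locales (use q1 in \<open>auto simp: add_power_q power_mult_distrib\<close>)

private lemma fixed_range: assumes "x ^ q = (x::'k)" shows "x \<in> range \<iota>"
proof -
  let ?P = "Polynomial.monom 1 q - [:0, 1:] :: 'k poly"
  let ?R = "{x. poly ?P x = 0}"
  have ne: "?P \<noteq> 0"
  proof
    assume "?P = 0"
    then have "Polynomial.coeff ?P q = 0" by simp
    then show False using q1 by (simp add: coeff_pCons split: nat.splits)
  qed
  have "degree ?P \<le> q" by (rule degree_diff_le) (use q1 in \<open>auto simp: degree_monom_le\<close>)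
  then have "card ?R \<le> q" using card_poly_roots_bound[OF ne] by simp
  moreover have "range \<iota> \<subseteq> ?R" by (auto simp: poly_monom hom_power[symmetric] power_q)
  moreover have "card (range \<iota>) = q" by (simp add: q card_image inj_f)
  ultimately have "range \<iota> = ?R"
    by (intro card_seteq) (use poly_roots_finite[OF ne] in auto)
  then show ?thesis using assms by (auto simp: poly_monom)
qed

private lemma coset_size: "0 < coset_size q n a" "[a * q ^ coset_size q n a = a] (mod n)"
proof -
  have "[a * q ^ totient n = a * 1] (mod n)"
    using euler_theorem[OF qn] by (rule cong_scalar_left)
  then have "0 < totient n \<and> [a * q ^ totient n = a] (mod n)" using n by simp
  from LeastI[of "\<lambda>d. 0 < d \<and> [a * q ^ d = a] (mod n)", OF this]
  show "0 < coset_size q n a" "[a * q ^ coset_size q n a = a] (mod n)"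
    by (auto simp: coset_size_def)
qed

private lemma coset_mem: "a * q ^ k mod n \<in> cyclotomic_coset q n a"
proof (induction k rule: less_induct)
  case (less k)
  let ?d = "coset_size q n a"
  show ?case
  proof (cases "k < ?d")
    case True
    then show ?thesis by (auto simp: cyclotomic_coset_def)
  next
    case False
    then have "a * q ^ k = a * q ^ ?d * q ^ (k - ?d)"
      by (simp add: mult.assoc flip: power_add)
    then have "[a * q ^ k = a * q ^ (k - ?d)] (mod n)"
      using cong_scalar_right[OF coset_size(2), of a "q ^ (k - ?d)"] by (simp only:)
    then show ?thesis using less[of "k - ?d"] False coset_size(1)[of a] by (auto simp: cong_def)
  qed
qed

private lemma coset_eq: "cyclotomic_coset q n a = range (\<lambda>k. a * q ^ k mod n)"
  using coset_mem by (auto simp: cyclotomic_coset_def)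

private lemma coset_finite: "finite (cyclotomic_coset q n a)"
  by (simp add: cyclotomic_coset_def)

private lemma coset_bij:
  "bij_betw (\<lambda>s. s * q mod n) (cyclotomic_coset q n a) (cyclotomic_coset q n a)"
proof -
  let ?B = "cyclotomic_coset q n a" let ?f = "\<lambda>s. s * q mod n"
  have step: "?f (a * q ^ k mod n) = a * q ^ Suc k mod n" for k
    by (simp only: mod_mult_left_eq power_Suc2 mult.assoc)
  have "?f ` ?B = ?B"
  proof
    have "?f (a * q ^ k mod n) \<in> ?B" for k unfolding step by (rule coset_mem)
    then show "?f ` ?B \<subseteq> ?B" by (auto simp: coset_eq)
    show "?B \<subseteq> ?f ` ?B"
    proof
      fix s assume "s \<in> ?B"
      then obtain k where s: "s = a * q ^ k mod n" by (auto simp: coset_eq)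
      let ?d = "coset_size q n a"
      have "[a * q ^ ?d * q ^ k = a * q ^ k] (mod n)"
        by (rule cong_scalar_right[OF coset_size(2)])
      then have "s = a * q ^ Suc (?d - 1 + k) mod n"
        using coset_size(1)[of a] s by (simp add: cong_def mult.assoc flip: power_add)
      then have "s = ?f (a * q ^ (?d - 1 + k) mod n)" by (simp only: step)
      then show "s \<in> ?f ` ?B" using coset_mem by blast
    qed
  qed
  moreover have "inj_on ?f ?B"
    by (rule eq_card_imp_inj_on) (simp_all only: coset_finite calculation)
  ultimately show ?thesis by (simp add: bij_betw_def)
qed

private lemma \<alpha>_mod: "\<alpha> ^ (s mod n) = \<alpha> ^ s"
proof -
  have "\<alpha> ^ s = \<alpha> ^ (n * (s div n) + s mod n)" by simp
  also have "\<dots> = \<alpha> ^ (s mod n)"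
    using \<alpha> by (simp only: power_add power_mult primitive_root_of_unity_def) simp
  finally show ?thesis by simp
qed

private lemma \<alpha>_inj: "inj_on (\<lambda>s. \<alpha> ^ s) {..<n}"
proof (rule linorder_inj_onI)
  fix s t assume st: "s < t" "s \<in> {..<n}" "t \<in> {..<n}"
  have \<alpha>0: "\<alpha> \<noteq> 0" using \<alpha> n by (auto simp: primitive_root_of_unity_def power_0_left)
  show "\<alpha> ^ s \<noteq> \<alpha> ^ t"
  proof
    assume "\<alpha> ^ s = \<alpha> ^ t"
    also have "\<alpha> ^ t = \<alpha> ^ s * \<alpha> ^ (t - s)" using st by (simp flip: power_add)
    finally have "\<alpha> ^ (t - s) = 1" using \<alpha>0 by simp
    then show False using \<alpha> st by (auto simp: primitive_root_of_unity_def)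
  qed
qed auto

lemma coset_min_poly_is_minimal_polynomial:
  "\<exists>p. monic p \<and> irreducible p \<and> map_poly \<iota> p = coset_min_poly q n \<alpha> i \<and>
     poly (map_poly \<iota> p) (\<alpha> ^ i) = 0"
proof -
  let ?B = "cyclotomic_coset q n i" let ?M = "coset_min_poly q n \<alpha> i"
  let ?F = "\<lambda>x::'k. x ^ q"
  interpret F: field_hom ?F by (rule frob)
  interpret FP: map_poly_comm_ring_hom ?F ..
  interpret IP: map_poly_comm_ring_hom \<iota> ..
  have "map_poly ?F ?M = (\<Prod>s\<in>?B. [:- (\<alpha> ^ (s * q mod n)), 1:])"
    by (simp add: coset_min_poly_def FP.hom_prod \<alpha>_mod power_mult F.hom_uminus)
  also have "\<dots> = ?M"
    unfolding coset_min_poly_def by (rule prod.reindex_bij_betw[OF coset_bij])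
  finally have "Polynomial.coeff ?M k ^ q = Polynomial.coeff ?M k" for k
    by (metis coeff_map_poly F.hom_zero)
  then have rng: "Polynomial.coeff ?M k \<in> range \<iota>" for k by (rule fixed_range)
  define p where "p = map_poly (inv_into UNIV \<iota>) ?M"
  have inv0: "inv_into UNIV \<iota> 0 = 0" using inv_into_f_f[OF inj_f, of 0] by simp
  have pM: "map_poly \<iota> p = ?M"
    by (rule poly_eqI) (simp add: p_def coeff_map_poly inv0 f_inv_into_f[OF rng])
  have Mm: "monic ?M" unfolding coset_min_poly_def by (rule monic_prod) simp
  have dM: "degree ?M = card ?B" unfolding coset_min_poly_def
    by (subst degree_prod_eq_sum_degree) auto
  have dp: "degree p = card ?B" using pM dM by (metis degree_map_poly_hom)
  have "\<iota> (lead_coeff p) = 1" using Mm dM dp by (simp flip: pM)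
  then have mp: "monic p" by simp
  have iB: "i mod n \<in> ?B" using coset_mem[of i 0] by simp
  have root: "poly ?M (\<alpha> ^ i) = 0"
    unfolding coset_min_poly_def poly_prod
    using iB coset_finite by (intro prod_zero bexI[of _ "i mod n"]) (auto simp: \<alpha>_mod)
  have deg: "card ?B \<le> degree f" if f: "f \<noteq> 0" "poly (map_poly \<iota> f) (\<alpha> ^ i) = 0" for f :: "'a poly"
  proof -
    have fr: "poly (map_poly \<iota> f) (x ^ q) = poly (map_poly \<iota> f) x ^ q" for x
    proof -
      have "map_poly ?F (map_poly \<iota> f) = map_poly \<iota> f"
        by (rule poly_eqI) (simp add: coeff_map_poly power_q q1 F.hom_zero flip: hom_power)
      then show ?thesis by (metis F.poly_map_poly)
    qed
    have r: "poly (map_poly \<iota> f) (\<alpha> ^ (i * q ^ k)) = 0" for k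
    proof (induction k)
      case (Suc k)
      have "\<alpha> ^ (i * q ^ Suc k) = (\<alpha> ^ (i * q ^ k)) ^ q" by (simp add: ac_simps flip: power_mult)
      then show ?case using Suc q1 by (simp only: fr) simp
    qed (use f in simp)
    have ne: "map_poly \<iota> f \<noteq> 0" using f by simp
    have "(\<lambda>s. \<alpha> ^ s) ` ?B \<subseteq> {x. poly (map_poly \<iota> f) x = 0}"
      using r by (auto simp: coset_eq \<alpha>_mod)
    then have "card ((\<lambda>s. \<alpha> ^ s) ` ?B) \<le> card {x. poly (map_poly \<iota> f) x = 0}"
      using poly_roots_finite[OF ne] by (rule card_mono[rotated])
    also have "\<dots> \<le> degree f" using card_poly_roots_bound[OF ne] by simp
    also have "card ((\<lambda>s. \<alpha> ^ s) ` ?B) = card ?B"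
      by (rule card_image, rule inj_on_subset[OF \<alpha>_inj]) (use n in \<open>auto simp: coset_eq\<close>)
    finally show ?thesis .
  qed
  have p0: "p \<noteq> 0" using mp by auto
  have "irreducible p"
  proof (rule irreducibleI)
    show "p \<noteq> 0" by fact
    have "card ?B > 0" using iB coset_finite card_gt_0_iff by blast
    then show "\<not> p dvd 1" using dp by (auto simp: is_unit_iff_degree[OF p0])
    fix f g assume fg: "p = f * g"
    then have ne: "f \<noteq> 0" "g \<noteq> 0" using p0 by auto
    then have d: "degree f + degree g = card ?B" using dp fg by (simp add: degree_mult_eq)
    have "poly (map_poly \<iota> f) (\<alpha> ^ i) * poly (map_poly \<iota> g) (\<alpha> ^ i) = 0"
      using root by (simp add: pM[symmetric] fg hom_distribs)
    then have "degree f = 0 \<or> degree g = 0" using deg[of f] deg[of g] d ne by auto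
    then show "f dvd 1 \<or> g dvd 1" using ne by (simp add: is_unit_iff_degree)
  qed
  then show ?thesis using mp pM root by auto
qed

end

text \<open>\<open>\<iota>\<close> embeds the field of the code into an extension field containing \<open>\<alpha>\<close>, \<open>L\<close> is the chosen
  set of coset leaders and \<open>S \<subseteq> L\<close> the set of leaders whose minimal polynomials make up the generator
  polynomial of \<open>E\<close>.\<close>

definition BZ :: "('a::field \<Rightarrow> 'k::field) \<Rightarrow> nat \<Rightarrow> nat \<Rightarrow> 'k \<Rightarrow> nat set \<Rightarrow> 'a vec set \<Rightarrow> 'k set" where
  "BZ \<iota> q n \<alpha> L E = (\<lambda>i. \<alpha> ^ i) `
     (THE S. S \<subseteq> L \<and> map_poly \<iota> (generator_poly n E) = (\<Prod>i\<in>S. coset_min_poly q n \<alpha> i))"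

end

theory Submission
  imports Defs
begin

text \<open>Over the field of the codes, \<open>n = -1 \<noteq> 0\<close>, so \<open>x\<^sup>n - 1\<close> is squarefree. A decomposition of the
  whole space dualizes, so \<open>(C, D)\<close> is an LCP iff the pair of duals is. For cyclic codes with
  generators \<open>g\<close> and \<open>h\<close>, the sum and the intersection are generated by the gcd and the lcm, so
  the pair is an LCP iff \<open>g h = x\<^sup>n - 1\<close>. Over the extension field \<open>g\<close> is the product of the minimal
  polynomials of those \<open>\<alpha>\<^sup>i\<close> with \<open>i\<close> a leader that are its roots, and \<open>x\<^sup>n - 1\<close> is the product over
  all leaders; hence \<open>g h = x\<^sup>n - 1\<close> says that the two sets of leaders are complementary.\<close>

section \<open>Linear codes and their duals\<close>

text \<open>The vector-space and module axioms packed into the subspace predicate hold for every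
  \<open>n\<close>, so only the closure conditions remain.\<close>

lemma linear_code_iff:
  "linear_code n (C :: 'a::field vec set) \<longleftrightarrow> C \<subseteq> carrier_vec n \<and> 0\<^sub>v n \<in> C \<and>
     (\<forall>x\<in>C. \<forall>y\<in>C. x + y \<in> C) \<and> (\<forall>a. \<forall>x\<in>C. a \<cdot>\<^sub>v x \<in> C)"
proof -
  interpret vec_space "TYPE('a)" n .
  have "vectorspace class_ring (module_vec TYPE('a) n)" "Module.module class_ring (module_vec TYPE('a) n)"
    by (rule vectorspace_axioms, rule module_axioms)
  then show ?thesis
    unfolding linear_code_def VectorSpace.subspace_def submodule_def module_vec_simps class_ring_simps by auto
qed

lemma mem_dual_code:
  "x \<in> dual_code n C \<longleftrightarrow> x \<in> carrier_vec n \<and> (\<forall>y\<in>C. x \<bullet> y = 0)"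
  by (simp add: dual_code_def vec_module.orthogonal_complement_def)

lemma linear_code_diff:
  assumes "linear_code n C" "x \<in> C" "y \<in> C"
  shows "x - y \<in> C"
proof -
  have "x - y = x + (- 1) \<cdot>\<^sub>v y"
    using assms by (auto simp: linear_code_iff intro!: eq_vecI)
  then show ?thesis using assms by (simp add: linear_code_iff)
qed

lemma linear_code_dual:
  assumes "C \<subseteq> carrier_vec n"
  shows "linear_code n (dual_code n (C :: 'a::field vec set))"
  using assms
  by (auto simp: linear_code_iff mem_dual_code subset_iff add_scalar_prod_distrib[of _ n])

lemma subset_dual_dual:
  assumes "C \<subseteq> carrier_vec n"
  shows "C \<subseteq> dual_code n (dual_code n (C :: 'a::field vec set))"
proof
  fix x assume x: "x \<in> C"
  have "x \<bullet> y = 0" if y: "y \<in> dual_code n C" for y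
    using x y assms comm_scalar_prod[of x n y] by (auto simp: mem_dual_code)
  then show "x \<in> dual_code n (dual_code n C)" using x assms by (auto simp: mem_dual_code)
qed

text \<open>A linear functional is determined by its values on the unit vectors; these become the
  coordinates of the representing vector.\<close>

lemma linear_functional_scalar_prod:
  fixes \<phi> :: "'a::field vec \<Rightarrow> 'a"
  assumes add: "\<And>x y. x \<in> carrier_vec n \<Longrightarrow> y \<in> carrier_vec n \<Longrightarrow> \<phi> (x + y) = \<phi> x + \<phi> y"
    and smult: "\<And>a x. x \<in> carrier_vec n \<Longrightarrow> \<phi> (a \<cdot>\<^sub>v x) = a * \<phi> x"
  obtains u where "u \<in> carrier_vec n" "\<And>w. w \<in> carrier_vec n \<Longrightarrow> \<phi> w = u \<bullet> w"
proof
  let ?u = "vec n (\<lambda>i. \<phi> (unit_vec n i))"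
  show "?u \<in> carrier_vec n" by simp
  fix w :: "'a vec" assume w: "w \<in> carrier_vec n"
  \<comment> \<open>Induction over truncations of \<open>w\<close>: each step adds one multiple of a
    unit vector, and \<open>k = n\<close> recovers \<open>w\<close>.\<close>
  have "\<phi> (vec n (\<lambda>i. if i < k then w $ i else 0)) = (\<Sum>i<k. \<phi> (unit_vec n i) * w $ i)"
    if "k \<le> n" for k
    using that
  proof (induction k)
    case 0
    have "vec n (\<lambda>i. if i < 0 then w $ i else 0) = 0 \<cdot>\<^sub>v 0\<^sub>v n" by auto
    then show ?case by (simp only: smult[OF zero_carrier_vec]) simp
  next
    case (Suc k)
    have "vec n (\<lambda>i. if i < Suc k then w $ i else 0)
        = vec n (\<lambda>i. if i < k then w $ i else 0) + w $ k \<cdot>\<^sub>v unit_vec n k"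
      using Suc.prems by (auto intro!: eq_vecI simp: less_Suc_eq)
    then show ?case using Suc by (simp add: add smult)
  qed
  from this[of n] have "\<phi> (vec n (\<lambda>i. if i < n then w $ i else 0))
      = (\<Sum>i<n. \<phi> (unit_vec n i) * w $ i)" by simp
  moreover have "vec n (\<lambda>i. if i < n then w $ i else 0) = w" using w by auto
  ultimately show "\<phi> w = ?u \<bullet> w" using w by (simp add: scalar_prod_def lessThan_atLeast0)
qed

text \<open>Let \<open>P\<close> be the projection onto \<open>C\<close> along \<open>D\<close>. Its
  adjoint splits any \<open>v\<close>: the vector \<open>u\<close> representing the functional that
  sends \<open>w\<close> to \<open>v \<bullet> P w\<close> kills \<open>D\<close>, since
  \<open>P\<close> vanishes there, and \<open>v - u\<close> kills \<open>C\<close>, since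
  \<open>P\<close> is the identity there. The duals meet trivially because a vector orthogonal to
  both codes is orthogonal to their sum, which contains all unit vectors.\<close>

lemma LCP_dual:
  fixes C D :: "'a::field vec set"
  assumes "LCP n C D"
  shows "LCP n (dual_code n C) (dual_code n D)"
proof -
  have lin: "linear_code n C" "linear_code n D"
    and sum: "{c + d |c d. c \<in> C \<and> d \<in> D} = carrier_vec n" and int: "C \<inter> D = {0\<^sub>v n}"
    using assms by (auto simp: LCP_def)
  have CV: "C \<subseteq> carrier_vec n" and DV: "D \<subseteq> carrier_vec n"
    using lin by (auto simp: linear_code_iff)
  define P where "P w = (SOME c. c \<in> C \<and> w - c \<in> D)" for w
  have P: "P w \<in> C \<and> w - P w \<in> D" if w: "w \<in> carrier_vec n" for w
  proof -
    obtain c d where cd: "w = c + d" "c \<in> C" "d \<in> D" using w sum by blast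
    moreover have "w - c = d" using cd subsetD[OF CV cd(2)] subsetD[OF DV cd(3)] by auto
    ultimately have "c \<in> C \<and> w - c \<in> D" by simp
    then show ?thesis unfolding P_def by (rule someI)
  qed
  \<comment> \<open>Two admissible components differ by an element of \<open>C \<inter> D\<close>.
    This makes the chosen \<open>P\<close> linear: below it suffices that \<open>P x + P y\<close>
    and \<open>a \<cdot>\<^sub>v P x\<close> are admissible.\<close>
  have uniq: "P w = c" if w: "w \<in> carrier_vec n" and c: "c \<in> C" "w - c \<in> D" for w c
  proof -
    have Pc: "P w \<in> carrier_vec n" and cc: "c \<in> carrier_vec n" using P[OF w] c CV by auto
    have "P w - c \<in> C" using P[OF w] c lin by (auto intro: linear_code_diff)
    moreover have "(w - c) - (w - P w) = P w - c" using w Pc cc by auto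
    then have "P w - c \<in> D" using P[OF w] c lin(2) by (metis linear_code_diff)
    ultimately have z: "P w - c = 0\<^sub>v n" using int by auto
    show ?thesis
    proof (rule eq_vecI)
      fix i assume i: "i < dim_vec c"
      from z have "(P w - c) $ i = (0\<^sub>v n :: 'a vec) $ i" by simp
      then show "P w $ i = c $ i" using i Pc cc by auto
    qed (use Pc cc in auto)
  qed
  have Pcar: "P w \<in> carrier_vec n" if "w \<in> carrier_vec n" for w using P[OF that] CV by auto
  have Padd: "P (x + y) = P x + P y" if xy: "x \<in> carrier_vec n" "y \<in> carrier_vec n" for x y
  proof (rule uniq)
    have "x + y - (P x + P y) = (x - P x) + (y - P y)"
      using xy Pcar[OF xy(1)] Pcar[OF xy(2)] by auto
    then show "x + y - (P x + P y) \<in> D"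
      using P[OF xy(1)] P[OF xy(2)] lin(2) by (auto simp: linear_code_iff)
    show "P x + P y \<in> C" using P[OF xy(1)] P[OF xy(2)] lin(1) by (auto simp: linear_code_iff)
  qed (use xy in auto)
  have Psmult: "P (a \<cdot>\<^sub>v x) = a \<cdot>\<^sub>v P x" if x: "x \<in> carrier_vec n" for a x
  proof (rule uniq)
    have "a \<cdot>\<^sub>v x - a \<cdot>\<^sub>v P x = a \<cdot>\<^sub>v (x - P x)"
      using x Pcar[OF x] by (auto simp: right_diff_distrib)
    then show "a \<cdot>\<^sub>v x - a \<cdot>\<^sub>v P x \<in> D"
      using P[OF x] lin(2) by (auto simp: linear_code_iff)
    show "a \<cdot>\<^sub>v P x \<in> C" using P[OF x] lin(1) by (auto simp: linear_code_iff)
  qed (use x in auto)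
  have "\<exists>a b. v = a + b \<and> a \<in> dual_code n C \<and> b \<in> dual_code n D"
    if v: "v \<in> carrier_vec n" for v
  proof -
    obtain u where u: "u \<in> carrier_vec n" "\<And>w. w \<in> carrier_vec n \<Longrightarrow> v \<bullet> P w = u \<bullet> w"
    proof (rule linear_functional_scalar_prod[of n "\<lambda>w. v \<bullet> P w"])
      fix x y :: "'a vec" and a :: 'a assume x: "x \<in> carrier_vec n" 
      show "v \<bullet> P (a \<cdot>\<^sub>v x) = a * (v \<bullet> P x)"
        using v Pcar[OF x] by (simp add: Psmult[OF x])
      assume y: "y \<in> carrier_vec n"
      show "v \<bullet> P (x + y) = v \<bullet> P x + v \<bullet> P y"
        using scalar_prod_add_distrib[OF v Pcar[OF x] Pcar[OF y]] by (simp add: Padd[OF x y])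
    qed blast
    have "u \<bullet> d = 0" if d: "d \<in> D" for d
    proof -
      have dc: "d \<in> carrier_vec n" using d DV by auto
      moreover have "d - 0\<^sub>v n = d" using dc by auto
      ultimately have "P d = 0\<^sub>v n" using d lin by (intro uniq) (auto simp: linear_code_iff)
      then show ?thesis using u(2)[OF dc] v by simp
    qed
    then have "u \<in> dual_code n D" using u by (simp add: mem_dual_code)
    moreover have "(v - u) \<bullet> c = 0" if c: "c \<in> C" for c
    proof -
      have cc: "c \<in> carrier_vec n" using c CV by auto
      moreover have "c - c = 0\<^sub>v n" using cc by auto
      ultimately have "P c = c" using c lin by (intro uniq) (auto simp: linear_code_iff)
      then show ?thesis using u(2)[OF cc] by (simp add: minus_scalar_prod_distrib[OF v u(1) cc])
    qed
    then have "v - u \<in> dual_code n C" using u v by (simp add: mem_dual_code)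
    moreover have "v = (v - u) + u" using u v by auto
    ultimately show ?thesis by blast
  qed
  moreover have "a + b \<in> carrier_vec n" if "a \<in> dual_code n C" "b \<in> dual_code n D" for a b
    using that by (auto simp: mem_dual_code)
  ultimately have "{c + d |c d. c \<in> dual_code n C \<and> d \<in> dual_code n D} = carrier_vec n"
    by blast
  moreover have "dual_code n C \<inter> dual_code n D = {0\<^sub>v n}"
  proof -
    have "x = 0\<^sub>v n" if x: "x \<in> dual_code n C" "x \<in> dual_code n D" for x
    proof (rule eq_vecI)
      fix i assume i: "i < dim_vec (0\<^sub>v n :: 'a vec)"
      have "unit_vec n i \<in> {c + d |c d. c \<in> C \<and> d \<in> D}" by (simp add: sum)
      then obtain c d where cd: "unit_vec n i = c + d" "c \<in> C" "d \<in> D" by blast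
      have "x \<bullet> unit_vec n i = x \<bullet> c + x \<bullet> d"
        unfolding cd(1) using x cd CV DV
        by (intro scalar_prod_add_distrib[of _ n]) (auto simp: mem_dual_code)
      then have "x \<bullet> unit_vec n i = 0" using x cd(2,3) by (simp add: mem_dual_code)
      then show "x $ i = (0\<^sub>v n :: 'a vec) $ i" using x i by (simp add: mem_dual_code)
    qed (use x in \<open>auto simp: mem_dual_code\<close>)
    moreover have "0\<^sub>v n \<in> dual_code n C" "0\<^sub>v n \<in> dual_code n D"
      using linear_code_dual[OF CV] linear_code_dual[OF DV] by (auto simp: linear_code_iff)
    ultimately show ?thesis by blast
  qed
  ultimately show ?thesis
    using linear_code_dual[OF CV] linear_code_dual[OF DV] by (simp add: LCP_def)
qed

text \<open>Dualizing twice a decomposition of the whole space only enlarges both summands, and two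
  summands of a direct sum cannot grow.\<close>

lemma dual_dual:
  fixes C W :: "'a::field vec set"
  assumes "LCP n C W"
  shows "dual_code n (dual_code n C) = C"
proof
  have lin: "linear_code n C" "linear_code n W"
    and sum: "{c + d |c d. c \<in> C \<and> d \<in> W} = carrier_vec n"
    using assms by (auto simp: LCP_def)
  have CV: "C \<subseteq> carrier_vec n" and WV: "W \<subseteq> carrier_vec n"
    using lin by (auto simp: linear_code_iff)
  let ?C = "dual_code n (dual_code n C)" and ?W = "dual_code n (dual_code n W)"
  have L: "LCP n ?C ?W" by (intro LCP_dual assms)
  show "C \<subseteq> ?C" by (rule subset_dual_dual[OF CV])
  show "?C \<subseteq> C"
  proof
    fix x assume x: "x \<in> ?C"
    then have "x \<in> carrier_vec n" by (simp add: mem_dual_code)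
    then obtain c w where cw: "x = c + w" "c \<in> C" "w \<in> W" using sum by blast
    have cc: "c \<in> carrier_vec n" "w \<in> carrier_vec n" using cw CV WV by auto
    have "x - c \<in> ?C" using L x cw subset_dual_dual[OF CV]
      by (auto simp: LCP_def intro: linear_code_diff)
    moreover have "x - c = w" using cw(1) cc by auto
    ultimately have "w \<in> ?C \<inter> ?W" using cw subset_dual_dual[OF WV] by auto
    then have "w = 0\<^sub>v n" using L by (auto simp: LCP_def)
    then show "x \<in> C" using cw cc by simp
  qed
qed

text \<open>The shift permutes coordinates and so preserves the scalar product. Every codeword
  \<open>c\<close> is the shift of some codeword \<open>b\<close>, so the product of a shifted
  \<open>u\<close> with \<open>c\<close> equals \<open>u \<bullet> b\<close>, which is zero.\<close>

lemma cyclic_code_dual: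
  assumes "cyclic_code n C"
  shows "cyclic_code n (dual_code n (C :: 'a::field vec set))"
proof -
  have CV: "C \<subseteq> carrier_vec n" and sh: "\<And>c. c \<in> C \<Longrightarrow> cyclic_shift n c \<in> C"
    using assms by (auto simp: cyclic_code_def linear_code_iff)
  have "cyclic_shift n u \<bullet> c = 0" if u: "u \<in> dual_code n C" and c: "c \<in> C" for u c
  proof (cases "n = 0")
    case True
    then show ?thesis using c CV by (auto simp: scalar_prod_def)
  next
    case False
    have uc: "u \<in> carrier_vec n" using u by (simp add: mem_dual_code)
    have cc: "c \<in> carrier_vec n" using c CV by auto
    \<comment> \<open>Each shift adds \<open>n - 1\<close> to the index modulo \<open>n\<close>.
      After \<open>n\<close> shifts every entry is back, so \<open>n - 1\<close> shifts of
      \<open>c\<close> give the word whose shift is \<open>c\<close>.\<close>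
    have it: "(cyclic_shift n ^^ k) c = vec n (\<lambda>i. c $ ((i + k * (n - 1)) mod n))" for k
    proof (induction k)
      case 0
      then show ?case using cc by (auto intro!: eq_vecI)
    next
      case (Suc k)
      have "((i + n - 1) mod n + k * (n - 1)) mod n = (i + Suc k * (n - 1)) mod n" for i
        using False by (simp add: mod_add_left_eq add.assoc)
      then show ?case using False Suc by (auto simp: cyclic_shift_def intro!: eq_vecI)
    qed
    have itC: "(cyclic_shift n ^^ k) c \<in> C" for k
      by (induction k) (use c sh in auto)
    define b where "b = (cyclic_shift n ^^ (n - 1)) c"
    have bC: "b \<in> C" unfolding b_def by (rule itC)
    then have bc: "b \<in> carrier_vec n" using CV by auto
    have "cyclic_shift n b = (cyclic_shift n ^^ n) c"
      unfolding b_def using False by (cases n) auto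
    also have "\<dots> = c" unfolding it using cc by (auto intro!: eq_vecI)
    finally have sb: "cyclic_shift n b = c" .
    have "cyclic_shift n u \<bullet> c = cyclic_shift n u \<bullet> cyclic_shift n b" by (simp only: sb)
    also have "\<dots> = (\<Sum>i<n. u $ ((i + n - 1) mod n) * b $ ((i + n - 1) mod n))"
      by (simp add: scalar_prod_def cyclic_shift_def lessThan_atLeast0)
    also have "\<dots> = (\<Sum>i<n. u $ i * b $ i)"
    proof (rule sum.reindex_bij_betw)
      have "inj_on (\<lambda>i. (i + n - 1) mod n) {..<n}"
      proof (rule inj_onI)
        fix i j assume ij: "i \<in> {..<n}" "j \<in> {..<n}" "(i + n - 1) mod n = (j + n - 1) mod n"
        \<comment> \<open>Adding 1 turns \<open>i + n - 1\<close> into \<open>i + n\<close>, which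
          is \<open>i\<close> modulo \<open>n\<close>.\<close>
        then have "((i + n - 1) + 1) mod n = ((j + n - 1) + 1) mod n" by (metis mod_add_left_eq)
        then show "i = j" using ij by simp
      qed
      moreover have "(\<lambda>i. (i + n - 1) mod n) ` {..<n} \<subseteq> {..<n}" using False by auto
      ultimately show "bij_betw (\<lambda>i. (i + n - 1) mod n) {..<n} {..<n}"
        by (simp add: bij_betw_def endo_inj_surj)
    qed
    also have "\<dots> = u \<bullet> b" using uc bc by (simp add: scalar_prod_def lessThan_atLeast0)
    also have "\<dots> = 0" using u bC by (simp add: mem_dual_code)
    finally show ?thesis .
  qed
  then show ?thesis
    using linear_code_dual[OF CV]
    by (auto simp: cyclic_code_def mem_dual_code cyclic_shift_def)
qed

section \<open>Cyclic codes as ideals\<close>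

text \<open>Division by a nonzero element of least degree leaves a remainder in \<open>I\<close>,
  which must vanish; scaling makes this element monic. The lemma yields both Bezout coefficients and
  generators of cyclic codes.\<close>

lemma polynomial_ideal_principal:
  fixes I :: "'a::field poly set"
  assumes add: "\<And>f g. f \<in> I \<Longrightarrow> g \<in> I \<Longrightarrow> f + g \<in> I"
    and mult: "\<And>f g. g \<in> I \<Longrightarrow> f * g \<in> I"
    and ex: "h \<in> I" "h \<noteq> 0"
  obtains g where "monic g" "\<And>f. f \<in> I \<longleftrightarrow> g dvd f"
proof -
  obtain g where g: "g \<in> I" "g \<noteq> 0" and min: "\<And>f. f \<in> I \<Longrightarrow> f \<noteq> 0 \<Longrightarrow> degree g \<le> degree f"
    using ex_has_least_nat[of "\<lambda>f. f \<in> I \<and> f \<noteq> 0" h degree] ex by blast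
  have iff: "f \<in> I \<longleftrightarrow> g dvd f" for f
  proof
    assume f: "f \<in> I"
    have "f mod g = f + (- (f div g)) * g" by (simp add: minus_mult_div_eq_mod[symmetric])
    then have "f mod g \<in> I" using add[OF f mult[OF g(1)]] by (simp only:)
    then have "f mod g = 0"
      using min[of "f mod g"] degree_mod_less[of g f] g(2) by (metis linorder_not_le)
    then show "g dvd f" by (simp add: mod_eq_0_iff_dvd)
  next
    assume "g dvd f"
    then obtain k where "f = k * g" by (metis dvdE mult.commute)
    then show "f \<in> I" using mult g by simp
  qed
  let ?g = "Polynomial.smult (inverse (lead_coeff g)) g"
  show ?thesis
  proof
    show "monic ?g" using g by simp
    show "f \<in> I \<longleftrightarrow> ?g dvd f" for f using g by (simp add: iff smult_dvd_iff)
  qed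
qed

text \<open>The ideal of all combinations of \<open>g\<close> and \<open>h\<close> has a generator
  dividing both, hence dividing 1, so the ideal contains 1.\<close>

lemma polynomial_bezout:
  fixes g h :: "'a::field poly"
  assumes "g \<noteq> 0" and "\<And>d. d dvd g \<Longrightarrow> d dvd h \<Longrightarrow> d dvd 1"
  obtains u v where "u * g + v * h = 1"
proof -
  let ?I = "{u * g + v * h |u v. True}"
  have mem: "u * g + v * h \<in> ?I" for u v by blast
  obtain d where d: "\<And>f. f \<in> ?I \<longleftrightarrow> d dvd f"
  proof (rule polynomial_ideal_principal[of ?I g])
    fix f1 f2 assume "f1 \<in> ?I" "f2 \<in> ?I"
    then obtain u1 v1 u2 v2 where "f1 = u1 * g + v1 * h" "f2 = u2 * g + v2 * h" by blast
    then have "f1 + f2 = (u1 + u2) * g + (v1 + v2) * h" by (simp add: algebra_simps)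
    then show "f1 + f2 \<in> ?I" using mem by (simp only:)
  next
    fix f f1 assume "f1 \<in> ?I"
    then obtain u1 v1 where "f1 = u1 * g + v1 * h" by blast
    then have "f * f1 = (f * u1) * g + (f * v1) * h" by (simp add: algebra_simps)
    then show "f * f1 \<in> ?I" using mem by (simp only:)
  next
    show "g \<in> ?I" using mem[of 1 0] by simp
  qed (use assms in auto)
  have "d dvd g" "d dvd h" using d[of g] d[of h] mem[of 1 0] mem[of 0 1] by simp_all
  then have "1 \<in> ?I" using assms d by blast
  then show ?thesis using that by force
qed

lemma monic_dvd_antisym:
  assumes "monic p" "monic q" "p dvd q" "q dvd (p :: 'a::field poly)"
  shows "p = q"
  using assms poly_dvd_antisym[of p q] by auto

section \<open>The modulus x^n - 1 and the polynomials of words\<close>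

abbreviation cyclic_modulus :: "nat \<Rightarrow> 'a::field poly" where
  "cyclic_modulus n \<equiv> Polynomial.monom 1 n - 1"

lemma coeff_cyclic_modulus:
  "Polynomial.coeff (cyclic_modulus n) i = (if i = n then 1 else 0) - (if i = 0 then 1 else 0)"
  by (simp add: coeff_1)

lemma degree_cyclic_modulus: "degree (cyclic_modulus n) = n"
proof (rule antisym)
  show "degree (cyclic_modulus n) \<le> n"
    by (rule degree_diff_le) (auto simp: degree_monom_le)
  show "n \<le> degree (cyclic_modulus n)"
    by (cases "n = 0") (auto intro!: le_degree simp: coeff_cyclic_modulus simp del: coeff_diff)
qed

lemma monic_cyclic_modulus: "0 < n \<Longrightarrow> monic (cyclic_modulus n)"
  by (simp add: degree_cyclic_modulus coeff_cyclic_modulus del: coeff_diff)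

lemma cyclic_modulus_nonzero:
  assumes "0 < n"
  shows "cyclic_modulus n \<noteq> (0 :: 'a::field poly)"
proof
  assume eq: "cyclic_modulus n = (0 :: 'a poly)"
  have "degree (cyclic_modulus n :: 'a poly) = n" by (rule degree_cyclic_modulus)
  then show False using assms by (simp only: eq) simp
qed

lemma coeff_code_poly: "Polynomial.coeff (code_poly n c) i = (if i < n then c $ i else 0)"
  by (simp add: code_poly_def coeff_sum)

lemma degree_code_poly: "0 < n \<Longrightarrow> degree (code_poly n c) < n"
  by (rule degree_lessI) (auto simp: coeff_code_poly)

lemma code_poly_mod:
  assumes "0 < n"
  shows "code_poly n c mod cyclic_modulus n = code_poly n c"
  using assms degree_code_poly[of n c] by (intro mod_poly_less) (simp add: degree_cyclic_modulus)

lemma code_poly_add: "x \<in> carrier_vec n \<Longrightarrow> y \<in> carrier_vec n \<Longrightarrow>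
    code_poly n (x + y) = code_poly n x + code_poly n y"
  by (rule poly_eqI) (auto simp: coeff_code_poly)

lemma code_poly_smult: "x \<in> carrier_vec n \<Longrightarrow>
    code_poly n (a \<cdot>\<^sub>v x) = Polynomial.smult a (code_poly n x)"
  by (rule poly_eqI) (auto simp: coeff_code_poly)

lemma code_poly_zero: "code_poly n (0\<^sub>v n) = 0"
  by (rule poly_eqI) (auto simp: coeff_code_poly)

lemma code_poly_vec:
  assumes "degree p < n"
  shows "code_poly n (vec n (Polynomial.coeff p)) = p"
  using assms by (intro poly_eqI) (auto simp: coeff_code_poly coeff_eq_0)

lemma code_poly_inject:
  assumes "x \<in> carrier_vec n" "y \<in> carrier_vec n" "code_poly n x = code_poly n y"
  shows "x = y"
proof (rule eq_vecI)
  fix i assume "i < dim_vec y"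
  then show "x $ i = y $ i"
    using assms(1,2) arg_cong[OF assms(3), of "\<lambda>p. Polynomial.coeff p i"]
    by (simp add: coeff_code_poly)
qed (use assms in auto)

lemma code_poly_mod_vec:
  assumes "0 < n"
  obtains c where "c \<in> carrier_vec n" "code_poly n c = p mod (cyclic_modulus n :: 'a::field poly)"
proof
  let ?p = "p mod (cyclic_modulus n :: 'a poly)"
  have ne: "(cyclic_modulus n :: 'a poly) \<noteq> 0" by (rule cyclic_modulus_nonzero[OF assms])
  have "degree ?p < n"
    using degree_mod_less[OF ne, of p] assms by (auto simp: degree_cyclic_modulus)
  then show "code_poly n (vec n (Polynomial.coeff ?p)) = ?p" by (rule code_poly_vec)
qed simp

text \<open>Multiplication by x moves the last entry to x^n; subtracting that entry times x^n - 1
  brings it back as the constant term.\<close>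

lemma code_poly_cyclic_shift:
  assumes "0 < n"
  shows "code_poly n (cyclic_shift n c) = ([:0, 1:] * code_poly n c) mod cyclic_modulus n"
proof -
  let ?N = "cyclic_modulus n" and ?p = "code_poly n c"
  have "Polynomial.coeff ([:0, 1:] * ?p) i
      = Polynomial.coeff (Polynomial.smult (c $ (n - 1)) ?N + code_poly n (cyclic_shift n c)) i" for i
  proof (cases i)
    case 0
    then show ?thesis using assms by (simp add: coeff_cyclic_modulus coeff_code_poly cyclic_shift_def)
  next
    case (Suc j)
    moreover from this have "j = n - 1" if "\<not> i < n" "j < n" using that by simp
    ultimately show ?thesis using assms
      by (auto simp: coeff_cyclic_modulus coeff_code_poly cyclic_shift_def)
  qed
  then have "[:0, 1:] * ?p = Polynomial.smult (c $ (n - 1)) ?N + code_poly n (cyclic_shift n c)"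
    by (rule poly_eqI)
  also have "\<dots> = code_poly n (cyclic_shift n c) + [:c $ (n - 1):] * ?N" by simp
  finally have "([:0, 1:] * ?p) mod ?N = code_poly n (cyclic_shift n c) mod ?N"
    by (simp only: mod_mult_self1)
  then show ?thesis by (simp only: code_poly_mod[OF assms])
qed

section \<open>Cyclic codes and their generator polynomials\<close>

text \<open>When \<open>g\<close> divides x^n - 1, reduction modulo x^n - 1 does not affect
  divisibility by \<open>g\<close>, so plain divisibility of the representative describes the ideal
  generated by \<open>g\<close> in the quotient.\<close>

definition ideal_code :: "nat \<Rightarrow> 'a::field poly \<Rightarrow> 'a vec set" where
  "ideal_code n g = {c \<in> carrier_vec n. g dvd code_poly n c}"

lemma linear_ideal_code: "linear_code n (ideal_code n g)"
  by (auto simp: linear_code_iff ideal_code_def code_poly_add code_poly_smult code_poly_zero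
      intro: dvd_smult)

text \<open>The preimage \<open>?I\<close> of the code under reduction is an ideal of the polynomial
  ring: linearity of the code gives sums and scalar multiples, the shift gives multiplication by x.
  It contains x^n - 1, which reduces to the zero word, so it is nonzero and its monic generator
  divides x^n - 1.\<close>

lemma cyclic_code_imp_ideal_code:
  fixes C :: "'a::field vec set"
  assumes n: "0 < n" and C: "cyclic_code n C"
  obtains g where "monic g" "g dvd cyclic_modulus n" "C = ideal_code n g"
proof -
  let ?N = "cyclic_modulus n :: 'a poly"
  let ?I = "{p. \<exists>c\<in>C. p mod ?N = code_poly n c}"
  have lin: "linear_code n C" and sh: "\<And>c. c \<in> C \<Longrightarrow> cyclic_shift n c \<in> C"
    using C by (auto simp: cyclic_code_def)
  have CV: "C \<subseteq> carrier_vec n" using lin by (simp add: linear_code_iff)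
  have add: "f + g \<in> ?I" if "f \<in> ?I" "g \<in> ?I" for f g
  proof -
    obtain c d where "c \<in> C" "d \<in> C" "f mod ?N = code_poly n c" "g mod ?N = code_poly n d"
      using \<open>f \<in> ?I\<close> \<open>g \<in> ?I\<close> by blast
    moreover from this have "c + d \<in> C" using lin by (simp add: linear_code_iff)
    moreover have "code_poly n (c + d) = code_poly n c + code_poly n d"
      using CV calculation by (intro code_poly_add) auto
    ultimately show ?thesis unfolding mem_Collect_eq poly_mod_add_left by metis
  qed
  have sm: "Polynomial.smult a g \<in> ?I" if g: "g \<in> ?I" for a g
  proof -
    obtain c where "c \<in> C" "g mod ?N = code_poly n c" using g by blast
    moreover from this have "a \<cdot>\<^sub>v c \<in> C" using lin by (simp add: linear_code_iff)
    moreover have "code_poly n (a \<cdot>\<^sub>v c) = Polynomial.smult a (code_poly n c)"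
      using CV calculation by (intro code_poly_smult) auto
    ultimately show ?thesis unfolding mem_Collect_eq mod_smult_left by metis
  qed
  have X: "[:0, 1:] * g \<in> ?I" if g: "g \<in> ?I" for g
  proof -
    obtain c where c: "c \<in> C" "g mod ?N = code_poly n c" using g by blast
    have "([:0, 1:] * g) mod ?N = ([:0, 1:] * (g mod ?N)) mod ?N" by (simp only: mod_mult_right_eq)
    also have "\<dots> = code_poly n (cyclic_shift n c)" by (simp only: c code_poly_cyclic_shift[OF n])
    finally show ?thesis using sh[OF c(1)] by blast
  qed
  have zero: "0 \<in> ?I"
    using lin code_poly_zero[of n, where ?'a='a] by (auto simp: linear_code_iff intro!: bexI[of _ "0\<^sub>v n"])
  \<comment> \<open>Closure under scalars and x extends to all multipliers by Horner's
    scheme.\<close>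
  have mult: "f * g \<in> ?I" if g: "g \<in> ?I" for f g
  proof (induction f)
    case 0
    then show ?case using zero by (simp only: mult_zero_left)
  next
    case (pCons a f)
    have "pCons a f * g = Polynomial.smult a g + [:0, 1:] * (f * g)" by simp
    then show ?case using add[OF sm[OF g] X[OF pCons.IH]] by (simp only:)
  qed
  have NI: "?N \<in> ?I" using zero by simp
  obtain g where g: "monic g" "\<And>f. f \<in> ?I \<longleftrightarrow> g dvd f"
  proof (rule polynomial_ideal_principal[OF add mult NI cyclic_modulus_nonzero[OF n]])
    fix g assume "monic g" "\<And>f. f \<in> ?I \<longleftrightarrow> g dvd f"
    then show thesis by (rule that)
  qed
  show ?thesis
  proof
    show "monic g" by fact
    show "g dvd ?N" using g NI by blast
    have "c \<in> C \<longleftrightarrow> code_poly n c \<in> ?I" if c: "c \<in> carrier_vec n" for c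
      using code_poly_inject[OF c] CV by (auto simp: code_poly_mod[OF n])
    then have "c \<in> C \<longleftrightarrow> g dvd code_poly n c" if "c \<in> carrier_vec n" for c
      using that by (simp only: g)
    then show "C = ideal_code n g" using CV unfolding ideal_code_def by blast
  qed
qed

lemma code_poly_image_ideal_code:
  fixes g :: "'a::field poly"
  assumes n: "0 < n" and g: "g dvd cyclic_modulus n"
  shows "code_poly n ` ideal_code n g = {(f * g) mod cyclic_modulus n |f. True}"
proof (intro equalityI subsetI)
  let ?N = "cyclic_modulus n :: 'a poly"
  fix p assume "p \<in> code_poly n ` ideal_code n g"
  then obtain c where c: "p = code_poly n c" "g dvd p" by (auto simp: ideal_code_def)
  then obtain f where "p = f * g" by (metis dvdE mult.commute)
  moreover have "p = p mod ?N" using c by (simp add: code_poly_mod[OF n])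
  ultimately show "p \<in> {(f * g) mod ?N |f. True}" by blast
next
  let ?N = "cyclic_modulus n :: 'a poly"
  fix p assume "p \<in> {(f * g) mod ?N |f. True}"
  then obtain f where p: "p = (f * g) mod ?N" by blast
  obtain c where c: "c \<in> carrier_vec n" "code_poly n c = p" unfolding p by (rule code_poly_mod_vec[OF n])
  have "g dvd p" unfolding p using g by (simp add: dvd_mod)
  then show "p \<in> code_poly n ` ideal_code n g" using c by (auto simp: ideal_code_def)
qed

text \<open>Two monic divisors of x^n - 1 that generate the same ideal divide each other, so the
  definite description has a unique witness.\<close>

lemma generator_poly_ideal_code:
  fixes g :: "'a::field poly"
  assumes n: "0 < n" and g: "monic g" "g dvd cyclic_modulus n"
  shows "generator_poly n (ideal_code n g) = g"
  unfolding generator_poly_def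
proof (rule the_equality)
  let ?N = "cyclic_modulus n :: 'a poly"
  show "monic g \<and> g dvd ?N \<and> code_poly n ` ideal_code n g = {f * g mod ?N |f. True}"
    using code_poly_image_ideal_code[OF n g(2)] g by simp
  fix h :: "'a poly"
  assume h: "monic h \<and> h dvd ?N \<and> code_poly n ` ideal_code n g = {f * h mod ?N |f. True}"
  then have eq: "{f * g mod ?N |f. True} = {f * h mod ?N |f. True}"
    using code_poly_image_ideal_code[OF n g(2)] by simp
  \<comment> \<open>The residue of \<open>a\<close> is the residue of a multiple of
    \<open>b\<close>; as \<open>b\<close> divides the modulus, it divides \<open>a\<close>
    itself.\<close>
  have dvd: "b dvd a" if b: "b dvd ?N" and sub: "{f * a mod ?N |f. True} \<subseteq> {f * b mod ?N |f. True}"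
    for a b
  proof -
    have "1 * a mod ?N \<in> {f * a mod ?N |f. True}" by blast
    then obtain f where "1 * a mod ?N = f * b mod ?N" using sub by blast
    then have "a mod ?N = f * b mod ?N" by (simp only: mult_1)
    moreover have "b dvd f * b mod ?N" using b by (simp add: dvd_mod)
    ultimately show "b dvd a" using b by (metis dvd_mod_iff)
  qed
  show "h = g" using h g dvd[of g h] dvd[of h g] eq by (intro monic_dvd_antisym) auto
qed

lemma cyclic_code_generator:
  assumes "0 < n" "cyclic_code n C"
  shows "monic (generator_poly n C)" "generator_poly n C dvd cyclic_modulus n"
    "C = ideal_code n (generator_poly n C)"
proof -
  obtain g where "monic g" "g dvd cyclic_modulus n" "C = ideal_code n g"
    using cyclic_code_imp_ideal_code assms by blast
  then show "monic (generator_poly n C)" "generator_poly n C dvd cyclic_modulus n"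
    "C = ideal_code n (generator_poly n C)"
    by (simp_all add: generator_poly_ideal_code[OF assms(1)])
qed

text \<open>The derivative of \<open>x\<^sup>n - 1\<close> shows that it is squarefree.\<close>

lemma cyclic_modulus_factors_coprime:
  fixes g h d :: "'a::field poly"
  assumes n: "of_nat n \<noteq> (0::'a)" and gh: "g * h = cyclic_modulus n" and d: "d dvd g" "d dvd h"
  shows "d dvd 1"
proof -
  let ?N = "cyclic_modulus n :: 'a poly"
  obtain k where k: "n = Suc k" using n by (cases n) auto
  have "pderiv ?N = g * pderiv h + h * pderiv g" by (simp add: pderiv_mult flip: gh)
  then have "d dvd pderiv ?N" using d by (metis dvd_add dvd_mult2)
  moreover have "d dvd ?N" using d gh by (metis dvd_mult2)
  \<comment> \<open>In this combination the terms in x^n cancel and only the constant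
    \<open>n\<close>, a unit, survives.\<close>
  ultimately have "d dvd [:0, 1:] * pderiv ?N - Polynomial.smult (of_nat n) ?N"
    by (intro dvd_diff[OF dvd_mult dvd_smult])
  also have "[:0, 1:] * pderiv ?N - Polynomial.smult (of_nat n) ?N = [:of_nat n:]"
  proof -
    have "pderiv ?N = Polynomial.monom (of_nat n) k" by (simp add: k pderiv_diff pderiv_monom)
    then have "[:0, 1:] * pderiv ?N = Polynomial.monom (of_nat n) n" by (simp add: k monom_Suc)
    then show ?thesis by (simp add: smult_diff_right smult_monom)
  qed
  also have "\<dots> dvd 1" using n by (simp add: is_unit_const_poly_iff)
  finally show ?thesis .
qed

section \<open>Complementary pairs in terms of generators\<close>

text \<open>Spanning forces \<open>g * h\<close> to divide x^n - 1, and trivial intersection forces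
  its degree up to \<open>n\<close>. Conversely, squarefreeness makes the factors coprime, and
  Bezout coefficients both split every word and show that a common word is a multiple of x^n -
  1.\<close>

lemma LCP_ideal_code:
  fixes g h :: "'a::field poly"
  assumes n: "of_nat n \<noteq> (0::'a)" and g: "monic g" "g dvd cyclic_modulus n"
    and h: "monic h" "h dvd cyclic_modulus n"
  shows "LCP n (ideal_code n g) (ideal_code n h) \<longleftrightarrow> g * h = cyclic_modulus n"
proof
  let ?N = "cyclic_modulus n :: 'a poly"
  have n0: "0 < n" using n by (cases n) auto
  {
    assume L: "LCP n (ideal_code n g) (ideal_code n h)"
    \<comment> \<open>Splitting the word of the constant polynomial 1 yields a Bezout identity for
      \<open>g\<close> and \<open>h\<close>.\<close>
    define e :: "'a vec" where "e = vec n (Polynomial.coeff 1)"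
    have e: "e \<in> carrier_vec n" "code_poly n e = 1" using n0 by (auto simp: e_def code_poly_vec)
    obtain c d where cd: "e = c + d" "c \<in> ideal_code n g" "d \<in> ideal_code n h"
      using L e(1) unfolding LCP_def by blast
    then have "1 = code_poly n c + code_poly n d"
      using e code_poly_add[of c n d] by (simp add: ideal_code_def)
    moreover obtain u v where "code_poly n c = g * u" "code_poly n d = h * v"
      using cd by (auto simp: ideal_code_def elim!: dvdE)
    ultimately have "?N = ?N * (g * u + h * v)" by simp
    also have "\<dots> = (?N * g) * u + (?N * h) * v" by (simp add: algebra_simps)
    \<comment> \<open>In the first summand \<open>?N\<close> contributes the factor
      \<open>h\<close>, in the second the factor \<open>g\<close>.\<close>
    also have "g * h dvd \<dots>"
      using mult_dvd_mono[OF dvd_refl[of g] h(2)] mult_dvd_mono[OF g(2) dvd_refl[of h]]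
      by (intro dvd_add[OF dvd_mult2 dvd_mult2]) (simp_all only: mult.commute[of g "?N"])
    finally have dvd: "g * h dvd ?N" .
    have m: "monic (g * h)" using g(1) h(1) by (rule monic_mult)
    have "?N \<noteq> 0" by (rule cyclic_modulus_nonzero[OF n0])
    then have "degree (g * h) \<le> n" using dvd_imp_degree_le[OF dvd] by (simp add: degree_cyclic_modulus)
    \<comment> \<open>A product of smaller degree would itself be the polynomial of a nonzero word
      in both codes.\<close>
    moreover have "\<not> degree (g * h) < n"
    proof
      assume "degree (g * h) < n"
      then have cp: "code_poly n (vec n (Polynomial.coeff (g * h))) = g * h" by (rule code_poly_vec)
      then have "vec n (Polynomial.coeff (g * h)) \<in> ideal_code n g \<inter> ideal_code n h"
        by (simp add: ideal_code_def)
      then have "vec n (Polynomial.coeff (g * h)) = 0\<^sub>v n" using L by (auto simp: LCP_def)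
      then have "g * h = 0" using cp code_poly_zero by metis
      then show False using m by auto
    qed
    ultimately have deg: "degree (g * h) = n" by simp
    obtain r where r: "?N = g * h * r" using dvd by (rule dvdE)
    have "g * h \<noteq> 0" "r \<noteq> 0" using r \<open>?N \<noteq> 0\<close> by auto
    then have "degree r = 0"
      using deg r degree_mult_eq[of "g * h" r] degree_cyclic_modulus[of n, where ?'a='a] by simp
    moreover have "lead_coeff r = 1"
      using monic_cyclic_modulus[OF n0, where ?'a='a] m r by (metis lead_coeff_mult mult_1)
    ultimately have "r = 1" by (metis monic_degree_0)
    then show "g * h = ?N" using r by simp
  }
  assume gh: "g * h = ?N"
  have "g \<noteq> 0" using g by auto
  then obtain u v where uv: "u * g + v * h = 1"
    using polynomial_bezout[of g h] cyclic_modulus_factors_coprime[OF n gh] by blast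
  have "p \<in> {c + d |c d. c \<in> ideal_code n g \<and> d \<in> ideal_code n h}" if p: "p \<in> carrier_vec n" for p
  proof -
    let ?p = "code_poly n p"
    obtain c where c: "c \<in> carrier_vec n" "code_poly n c = (?p * u * g) mod ?N" by (rule code_poly_mod_vec[OF n0])
    obtain d where d: "d \<in> carrier_vec n" "code_poly n d = (?p * v * h) mod ?N" by (rule code_poly_mod_vec[OF n0])
    have "code_poly n (c + d) = (?p * u * g + ?p * v * h) mod ?N"
      using c d by (simp add: code_poly_add poly_mod_add_left)
    also have "?p * u * g + ?p * v * h = ?p * (u * g + v * h)" by (simp add: algebra_simps)
    also have "\<dots> mod ?N = ?p" using code_poly_mod[OF n0] by (simp add: uv)
    finally have "c + d = p" using c d p by (intro code_poly_inject) auto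
    moreover have "c \<in> ideal_code n g" "d \<in> ideal_code n h"
      using c d g h by (auto simp: ideal_code_def dvd_mod)
    ultimately show ?thesis by blast
  qed
  moreover have "c + d \<in> carrier_vec n" if "c \<in> ideal_code n g" "d \<in> ideal_code n h" for c d
    using that by (auto simp: ideal_code_def)
  ultimately have sum: "{c + d |c d. c \<in> ideal_code n g \<and> d \<in> ideal_code n h} = carrier_vec n"
    by blast
  have zero: "p = 0\<^sub>v n" if p: "p \<in> ideal_code n g" "p \<in> ideal_code n h" for p
  proof -
    let ?p = "code_poly n p"
    have "?p = ?p * (u * g + v * h)" by (simp add: uv)
    also have "\<dots> = u * (g * ?p) + v * (?p * h)" by (simp add: algebra_simps)
    \<comment> \<open>Both \<open>g\<close> and \<open>h\<close> divide \<open>?p\<close>, so each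
      summand contains one factor explicitly and the other through \<open>?p\<close>.\<close>
    also have "g * h dvd \<dots>"
      using p by (intro dvd_add[OF dvd_mult dvd_mult]) (simp_all add: ideal_code_def mult_dvd_mono)
    finally have "?N dvd ?p" by (simp only: gh)
    then have "?p = 0" using code_poly_mod[OF n0, of p] by (simp add: dvd_imp_mod_0)
    then show ?thesis using p code_poly_zero[of n, where ?'a='a]
      by (intro code_poly_inject[of p n]) (auto simp: ideal_code_def)
  qed
  have "0\<^sub>v n \<in> ideal_code n g \<inter> ideal_code n h"
    by (simp add: ideal_code_def code_poly_zero)
  then have int: "ideal_code n g \<inter> ideal_code n h = {0\<^sub>v n}" using zero by blast
  show "LCP n (ideal_code n g) (ideal_code n h)"
    unfolding LCP_def by (intro conjI linear_ideal_code sum int)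
qed

text \<open>The cofactor of the generator in x^n - 1 generates a complementary code, which supplies
  the decomposition required by \<open>dual_dual\<close>.\<close>

lemma cyclic_code_dual_dual:
  fixes C :: "'a::field vec set"
  assumes n: "of_nat n \<noteq> (0::'a)" and C: "cyclic_code n C"
  shows "dual_code n (dual_code n C) = C"
proof -
  have n0: "0 < n" using n by (cases n) auto
  note g = cyclic_code_generator[OF n0 C]
  obtain h where h: "cyclic_modulus n = generator_poly n C * h" using g(2) by (rule dvdE)
  moreover have "monic h"
    using monic_cyclic_modulus[OF n0, where ?'a='a] g(1) h by (metis lead_coeff_mult mult_1)
  ultimately have "LCP n (ideal_code n (generator_poly n C)) (ideal_code n h)"
    using LCP_ideal_code[OF n g(1,2)] by auto
  then show ?thesis using dual_dual g(3) by metis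
qed

text \<open>Since cyclic codes equal their double duals, applying \<open>LCP_dual\<close> to the
  duals gives its converse.\<close>

lemma LCP_iff_dual_generators:
  fixes C D :: "'a::field vec set"
  assumes n: "of_nat n \<noteq> (0::'a)" and C: "cyclic_code n C" and D: "cyclic_code n D"
  shows "LCP n C D \<longleftrightarrow>
    generator_poly n (dual_code n C) * generator_poly n (dual_code n D) = cyclic_modulus n"
proof -
  have n0: "0 < n" using n by (cases n) auto
  note gC = cyclic_code_generator[OF n0 cyclic_code_dual[OF C]]
  note gD = cyclic_code_generator[OF n0 cyclic_code_dual[OF D]]
  have "LCP n C D \<longleftrightarrow> LCP n (dual_code n C) (dual_code n D)"
    using LCP_dual[of n C D] LCP_dual[of n "dual_code n C" "dual_code n D"]
      cyclic_code_dual_dual[OF n C] cyclic_code_dual_dual[OF n D] by auto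
  then show ?thesis using LCP_ideal_code[OF n gC(1,2) gD(1,2)] gC(3) gD(3) by simp
qed

section \<open>Cyclotomic cosets and basic zeros\<close>

lemma monic_factor_linear:
  assumes "monic p" "poly p (a :: 'a::field) = 0"
  obtains r where "p = [:- a, 1:] * r" "monic r" "degree p = Suc (degree r)"
proof -
  have "[:- a, 1:] dvd p" using assms(2) by (simp only: poly_eq_0_iff_dvd)
  then obtain r where r: "p = [:- a, 1:] * r" by (rule dvdE)
  have m: "monic r" using assms(1) unfolding r lead_coeff_mult by simp
  then have "degree p = Suc (degree r)" unfolding r by (subst degree_mult_eq) auto
  then show ?thesis using that r m by blast
qed

text \<open>Roots are split off one at a time: the remaining ones, being different from
  \<open>a\<close>, stay roots of the quotient, and the degree count leaves the constant 1.\<close>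

lemma monic_eq_prod_linear:
  fixes p :: "'a::field poly"
  assumes "finite A" "monic p" "degree p = card A" "\<And>a. a \<in> A \<Longrightarrow> poly p a = 0"
  shows "p = (\<Prod>a\<in>A. [:- a, 1:])"
  using assms
proof (induction A arbitrary: p)
  case empty
  then show ?case using monic_degree_0[of p] by simp
next
  case (insert a A)
  obtain r where r: "p = [:- a, 1:] * r" "monic r" "degree p = Suc (degree r)"
    using monic_factor_linear insert.prems by blast
  have "poly r b = 0" if "b \<in> A" for b
    using insert.prems(3)[of b] insert.hyps(2) that by (auto simp: r(1))
  then have "r = (\<Prod>a\<in>A. [:- a, 1:])" using insert r by (intro insert.IH) auto
  then show ?case using insert.hyps r(1) by simp
qed

text \<open>By induction on \<open>A\<close>: the factor belonging to \<open>a\<close> is cancelled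
  against \<open>p\<close> if \<open>a\<close> is a root of \<open>p\<close>, and otherwise against
  the cofactor.\<close>

lemma monic_dvd_prod_linear:
  fixes p :: "'a::field poly"
  assumes "finite A" "monic p" "p dvd (\<Prod>a\<in>A. [:- a, 1:])"
  shows "p = (\<Prod>a\<in>{a \<in> A. poly p a = 0}. [:- a, 1:])"
  using assms
proof (induction A arbitrary: p)
  case empty
  then have "degree p = 0" using dvd_imp_degree_le[of p 1] by simp
  then show ?case using empty monic_degree_0[of p] by simp
next
  case (insert a A)
  let ?l = "[:- a, 1:]" and ?R = "\<Prod>a\<in>A. [:- a, 1:]"
  have "p dvd ?l * ?R" using insert.prems(2) unfolding prod.insert[OF insert.hyps] .
  then obtain h where h: "?l * ?R = p * h" by (rule dvdE)
  show ?case
  proof (cases "poly p a = 0")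
    case True
    obtain r where r: "p = ?l * r" "monic r" using monic_factor_linear insert.prems True by blast
    have "?l * ?R = ?l * (r * h)" using h by (simp only: r mult.assoc)
    then have "?R = r * h" by (subst (asm) mult_cancel_left) auto
    then have "r dvd ?R" by simp
    then have "r = (\<Prod>a\<in>{a \<in> A. poly r a = 0}. [:- a, 1:])" by (rule insert.IH[OF r(2)])
    moreover have "{b \<in> insert a A. poly p b = 0} = insert a {b \<in> A. poly r b = 0}"
      using insert.hyps by (auto simp: r(1))
    ultimately show ?thesis using insert.hyps r(1) by simp
  next
    case False
    have "poly (p * h) a = 0" by (simp flip: h)
    then have "poly h a = 0" using False by simp
    then have "?l dvd h" by (simp only: poly_eq_0_iff_dvd)
    then obtain k where k: "h = ?l * k" by (rule dvdE)
    have "?l * ?R = ?l * (p * k)" using h by (simp only: k mult.left_commute)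
    then have "?R = p * k" by (subst (asm) mult_cancel_left) auto
    then have "p dvd ?R" by simp
    then have "p = (\<Prod>a\<in>{a \<in> A. poly p a = 0}. [:- a, 1:])" by (rule insert.IH[OF insert.prems(1)])
    moreover have "{b \<in> insert a A. poly p b = 0} = {b \<in> A. poly p b = 0}" using False by auto
    ultimately show ?thesis by simp
  qed
qed

section \<open>Cosets, leaders and minimal polynomials\<close>

locale cyclotomic_cosets =
  fixes \<iota> :: "'a::{field,finite} \<Rightarrow> 'k::field" and \<alpha> :: 'k and q m n :: nat and L :: "nat set"
  assumes hom: "field_hom \<iota>"
    and q: "q = CARD('a)"
    and m: "m \<ge> 1"
    and n: "n = q ^ m - 1"
    and \<alpha>: "primitive_root_of_unity n \<alpha>"
    and L: "coset_leaders q n L"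
begin

sublocale field_hom \<iota> by (rule hom)

sublocale \<iota>P: map_poly_comm_ring_hom \<iota> ..

abbreviation B :: "nat \<Rightarrow> nat set" where "B \<equiv> cyclotomic_coset q n"
abbreviation M :: "nat \<Rightarrow> 'k poly" where "M \<equiv> coset_min_poly q n \<alpha>"

lemma q_power: "q ^ m = Suc n"
proof -
  have "q > 0" by (simp add: q)
  then show ?thesis by (simp add: n)
qed

lemma n_pos: "0 < n"
proof -
  have "card {0, 1::'a} \<le> card (UNIV :: 'a set)" by (rule card_mono) auto
  then have "1 < q ^ m" using m by (intro one_less_power) (auto simp: q)
  then show ?thesis by (simp add: q_power)
qed

lemma coprime_q_n: "coprime q n"
proof -
  have "coprime (q ^ m) n" by (simp add: q_power)
  then show ?thesis using m by simp
qed

lemma of_nat_n_nonzero: "of_nat n \<noteq> (0::'a)"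
proof
  assume "of_nat n = (0::'a)"
  \<comment> \<open>The characteristic divides the order of the field, so \<open>q ^ m\<close>,
    which is \<open>Suc n\<close>, vanishes and \<open>n\<close> becomes -1.\<close>
  have "of_nat q = (0::'a)" using CHAR_dvd_CARD[where ?'a='a] by (simp add: q of_nat_eq_0_iff_char_dvd)
  then have "of_nat (q ^ m) = (0::'a)" using m by simp
  then show False using \<open>of_nat n = 0\<close> by (simp add: q_power)
qed

lemma \<alpha>_inj: "inj_on (\<lambda>s. \<alpha> ^ s) {..<n}"
proof (rule linorder_inj_onI)
  fix s t assume st: "s < t" "s \<in> {..<n}" "t \<in> {..<n}"
  have \<alpha>0: "\<alpha> \<noteq> 0" using \<alpha> n_pos by (auto simp: primitive_root_of_unity_def power_0_left)
  show "\<alpha> ^ s \<noteq> \<alpha> ^ t"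
  proof
    assume "\<alpha> ^ s = \<alpha> ^ t"
    also have "\<alpha> ^ t = \<alpha> ^ s * \<alpha> ^ (t - s)" using st by (simp flip: power_add)
    finally have "\<alpha> ^ (t - s) = 1" using \<alpha>0 by simp
    then show False using \<alpha> st by (auto simp: primitive_root_of_unity_def)
  qed
qed auto

lemma coset_subset: "B i \<subseteq> {..<n}"
  using n_pos by (auto simp: cyclotomic_coset_def)

lemma finite_coset: "finite (B i)"
  using coset_subset finite_subset by blast

lemma self_in_coset:
  assumes "i < n"
  shows "i \<in> B i"
proof -
  \<comment> \<open>The exponent \<open>m\<close> witnesses that the \<open>LEAST\<close> in
    \<open>coset_size\<close> exists and is positive, so exponent 0 is admissible and yields
    \<open>i\<close> itself.\<close>
  have "[i * q ^ m = i] (mod n)" by (simp add: q_power cong_def)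
  then have "0 < m \<and> [i * q ^ m = i] (mod n)" using m by simp
  then have "0 < coset_size q n i" unfolding coset_size_def by (rule LeastI2) blast
  then show ?thesis using assms by (auto simp: cyclotomic_coset_def intro!: image_eqI[of _ _ 0])
qed

lemma root_coset_min_poly:
  assumes "s < n"
  shows "poly (M i) (\<alpha> ^ s) = 0 \<longleftrightarrow> s \<in> B i"
proof -
  have "poly (M i) (\<alpha> ^ s) = (\<Prod>t\<in>B i. \<alpha> ^ s - \<alpha> ^ t)"
    by (simp add: coset_min_poly_def poly_prod)
  then have "poly (M i) (\<alpha> ^ s) = 0 \<longleftrightarrow> (\<exists>t\<in>B i. \<alpha> ^ s = \<alpha> ^ t)"
    by (simp add: prod_zero_iff[OF finite_coset])
  moreover have "\<alpha> ^ s = \<alpha> ^ t \<longleftrightarrow> s = t" if "t \<in> B i" for t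
    using inj_on_eq_iff[OF \<alpha>_inj] assms that coset_subset by blast
  ultimately show ?thesis by blast
qed

text \<open>If the irreducible \<open>p\<close> did not divide \<open>g\<close>, the two would be
  coprime, and a Bezout identity evaluated at the common root \<open>\<alpha> ^ i\<close> would read
  0 = 1.\<close>

lemma minimal_polynomial:
  "\<exists>p. monic p \<and> irreducible p \<and> map_poly \<iota> p = M i \<and>
     (\<forall>g. poly (map_poly \<iota> g) (\<alpha> ^ i) = 0 \<longrightarrow> p dvd g)"
proof -
  obtain p where p: "monic p" "irreducible p" "map_poly \<iota> p = M i" "poly (map_poly \<iota> p) (\<alpha> ^ i) = 0"
    using coset_min_poly_is_minimal_polynomial[OF hom q \<alpha> n_pos coprime_q_n] by blast
  have "p dvd g" if g: "poly (map_poly \<iota> g) (\<alpha> ^ i) = 0" for g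
  proof (rule ccontr)
    assume ndvd: "\<not> p dvd g"
    have coprime: "d dvd 1" if "d dvd p" "d dvd g" for d
      using irreducibleD'[OF p(2) that(1)] that(2) ndvd dvd_trans by blast
    have "p \<noteq> 0" using p(1) by auto
    then obtain u v where "u * p + v * g = 1" by (rule polynomial_bezout[OF _ coprime])
    then have "map_poly \<iota> (u * p + v * g) = 1" by simp
    then have "map_poly \<iota> u * map_poly \<iota> p + map_poly \<iota> v * map_poly \<iota> g = 1"
      by (simp only: \<iota>P.hom_add \<iota>P.hom_mult)
    from arg_cong[OF this, of "\<lambda>f. poly f (\<alpha> ^ i)"] show False using g p(4) by simp
  qed
  then show ?thesis using p(1-3) by blast
qed

text \<open>The minimal polynomial of \<open>\<alpha> ^ i\<close> divides \<open>g\<close> and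
  vanishes on the whole coset.\<close>

lemma root_coset:
  assumes "poly (map_poly \<iota> g) (\<alpha> ^ i) = 0" "s \<in> B i"
  shows "poly (map_poly \<iota> g) (\<alpha> ^ s) = 0"
proof -
  obtain p where p: "map_poly \<iota> p = M i" "p dvd g" using minimal_polynomial[of i] assms(1) by blast
  from p(2) obtain r where "g = p * r" by (rule dvdE)
  then have "map_poly \<iota> g = M i * map_poly \<iota> r" by (simp only: \<iota>P.hom_mult p)
  moreover have "poly (M i) (\<alpha> ^ s) = 0"
    using assms(2) root_coset_min_poly coset_subset by blast
  ultimately show ?thesis by simp
qed

text \<open>The minimal polynomial of \<open>\<alpha> ^ s\<close> divides that of
  \<open>\<alpha> ^ i\<close>; both are monic and irreducible, so they coincide, and the cosets are
  recovered from their roots.\<close>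

lemma coset_eq:
  assumes "s \<in> B i"
  shows "B s = B i"
proof -
  have s: "s < n" using assms coset_subset by auto
  obtain p where p: "monic p" "irreducible p" "map_poly \<iota> p = M i"
    using minimal_polynomial[of i] by blast
  obtain p' where p': "monic p'" "irreducible p'" "map_poly \<iota> p' = M s"
    "\<And>g. poly (map_poly \<iota> g) (\<alpha> ^ s) = 0 \<Longrightarrow> p' dvd g"
    using minimal_polynomial[of s] by blast
  have "p' dvd p" using assms s by (intro p'(4)) (simp add: p(3) root_coset_min_poly)
  moreover from this have "p dvd p'" using irreducibleD'[OF p(2)] irreducible_not_unit[OF p'(2)] by blast
  ultimately have "p' = p" using p(1) p'(1) by (intro monic_dvd_antisym)
  then have "M s = M i" using p p' by simp
  then have "t \<in> B s \<longleftrightarrow> t \<in> B i" if "t < n" for t using root_coset_min_poly[OF that] by metis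
  then show ?thesis using coset_subset by blast
qed

lemma leaders_subset: "L \<subseteq> {..<n}"
  using L by (simp add: coset_leaders_def)

lemma finite_leaders: "finite L"
  using leaders_subset finite_subset by blast

lemma leader_exists:
  assumes "s < n"
  obtains i where "i \<in> L" "s \<in> B i"
proof -
  have "\<exists>!i. i \<in> L \<and> i \<in> B s" using L assms by (simp add: coset_leaders_def)
  then obtain i where i: "i \<in> L" "i \<in> B s" by blast
  then have "s \<in> B i" using self_in_coset[OF assms] coset_eq[OF i(2)] by blast
  with i(1) show ?thesis by (rule that)
qed

lemma leader_unique:
  assumes "i \<in> L" "j \<in> L" "s \<in> B i" "s \<in> B j"
  shows "i = j"
proof -
  have "B i = B j" using coset_eq[OF assms(3)] coset_eq[OF assms(4)] by simp
  moreover have "i < n" "j < n" using assms leaders_subset by auto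
  ultimately have "i \<in> B j" "j \<in> B j" using self_in_coset by auto
  moreover have "\<exists>!k. k \<in> L \<and> k \<in> B j" using L \<open>j < n\<close> by (simp add: coset_leaders_def)
  ultimately show ?thesis using assms(1,2) by blast
qed

section \<open>Divisors of x^n - 1 as products over leaders\<close>

lemma map_cyclic_modulus: "map_poly \<iota> (cyclic_modulus n) = cyclic_modulus n"
  by (rule poly_eqI) (simp add: coeff_map_poly coeff_1 hom_uminus)

text \<open>The \<open>n\<close> powers of \<open>\<alpha>\<close> are distinct roots, as many as
  the degree.\<close>

lemma cyclic_modulus_eq_prod:
  "(cyclic_modulus n :: 'k poly) = (\<Prod>a\<in>(\<lambda>s. \<alpha> ^ s) ` {..<n}. [:- a, 1:])"
proof (rule monic_eq_prod_linear)
  show "monic (cyclic_modulus n :: 'k poly)" by (rule monic_cyclic_modulus[OF n_pos])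
  show "degree (cyclic_modulus n :: 'k poly) = card ((\<lambda>s. \<alpha> ^ s) ` {..<n})"
    by (simp add: degree_cyclic_modulus card_image[OF \<alpha>_inj])
  fix a assume "a \<in> (\<lambda>s. \<alpha> ^ s) ` {..<n}"
  then obtain s where "a = \<alpha> ^ s" by blast
  then have "a ^ n = (\<alpha> ^ n) ^ s" by (simp add: mult.commute flip: power_mult)
  then show "poly (cyclic_modulus n) a = 0"
    using \<alpha> by (simp add: poly_monom primitive_root_of_unity_def)
qed simp

text \<open>For the generator of a cyclic code this is the index set singled out by the definite
  description in \<open>BZ\<close>.\<close>

definition leader_roots :: "'a poly \<Rightarrow> nat set" where
  "leader_roots g = {i \<in> L. poly (map_poly \<iota> g) (\<alpha> ^ i) = 0}"

text \<open>The image of \<open>g\<close> splits into linear factors over its roots among the powers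
  of \<open>\<alpha>\<close>. The exponents of these roots form a union of whole cosets, which are
  disjoint for distinct leaders, so the factors regroup by leader.\<close>

lemma map_divisor_eq_prod:
  assumes g: "monic g" "g dvd cyclic_modulus n"
  shows "map_poly \<iota> g = (\<Prod>i\<in>leader_roots g. M i)"
proof -
  let ?g = "map_poly \<iota> g" and ?Z = "{s. s < n \<and> poly (map_poly \<iota> g) (\<alpha> ^ s) = 0}"
  have mg: "monic ?g" using g(1) by simp
  obtain r where "cyclic_modulus n = g * r" using g(2) by (rule dvdE)
  then have "?g dvd cyclic_modulus n"
    using map_cyclic_modulus by (metis \<iota>P.hom_mult dvd_triv_left)
  then have "?g = (\<Prod>a\<in>{a \<in> (\<lambda>s. \<alpha> ^ s) ` {..<n}. poly ?g a = 0}. [:- a, 1:])"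
    using mg by (intro monic_dvd_prod_linear) (simp_all add: cyclic_modulus_eq_prod)
  also have "{a \<in> (\<lambda>s. \<alpha> ^ s) ` {..<n}. poly ?g a = 0} = (\<lambda>s. \<alpha> ^ s) ` ?Z" by auto
  also have "(\<Prod>a\<in>(\<lambda>s. \<alpha> ^ s) ` ?Z. [:- a, 1:]) = (\<Prod>s\<in>?Z. [:- (\<alpha> ^ s), 1:])"
    using inj_on_subset[OF \<alpha>_inj, of ?Z] by (subst prod.reindex) (auto simp: o_def)
  also have "?Z = (\<Union>i\<in>leader_roots g. B i)"
  proof (intro equalityI subsetI)
    fix s assume s: "s \<in> ?Z"
    then obtain i where i: "i \<in> L" "s \<in> B i" using leader_exists by blast
    \<comment> \<open>The root is known at \<open>s\<close>; transporting it to the leader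
      \<open>i\<close> needs the membership in this direction.\<close>
    then have "i \<in> B s" using coset_eq[of s i] self_in_coset leaders_subset by blast
    then show "s \<in> (\<Union>i\<in>leader_roots g. B i)"
      using s i root_coset[of g s i] by (auto simp: leader_roots_def)
  next
    fix s assume "s \<in> (\<Union>i\<in>leader_roots g. B i)"
    then obtain i where "poly ?g (\<alpha> ^ i) = 0" "s \<in> B i" by (auto simp: leader_roots_def)
    then show "s \<in> ?Z" using root_coset[of g i s] coset_subset[of i] by auto
  qed
  also have "(\<Prod>s\<in>(\<Union>i\<in>leader_roots g. B i). [:- (\<alpha> ^ s), 1:]) = (\<Prod>i\<in>leader_roots g. M i)"
    unfolding coset_min_poly_def
  proof (rule prod.UNION_disjoint)
    show "finite (leader_roots g)" using finite_leaders by (simp add: leader_roots_def)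
    show "\<forall>i\<in>leader_roots g. \<forall>j\<in>leader_roots g. i \<noteq> j \<longrightarrow> B i \<inter> B j = {}"
    proof (intro ballI impI)
      fix i j assume "i \<in> leader_roots g" "j \<in> leader_roots g" "i \<noteq> j"
      then show "B i \<inter> B j = {}" using leader_unique[of i j] by (auto simp: leader_roots_def)
    qed
  qed (simp add: finite_coset)
  finally show ?thesis .
qed

text \<open>At a leader \<open>i\<close> only the factor of its own coset can vanish, so the product
  determines \<open>S\<close>.\<close>

lemma prod_coset_min_poly_unique:
  assumes S: "S \<subseteq> L" and g: "map_poly \<iota> g = (\<Prod>i\<in>S. M i)"
  shows "S = leader_roots g"
proof -
  have fin: "finite S" using S finite_leaders by (rule finite_subset)
  have "i \<in> S \<longleftrightarrow> poly (map_poly \<iota> g) (\<alpha> ^ i) = 0" if i: "i \<in> L" for i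
  proof -
    have lt: "i < n" using i leaders_subset by auto
    have "poly (map_poly \<iota> g) (\<alpha> ^ i) = 0 \<longleftrightarrow> (\<exists>j\<in>S. i \<in> B j)"
      using fin by (simp add: g poly_prod prod_zero_iff root_coset_min_poly[OF lt])
    also have "\<dots> \<longleftrightarrow> i \<in> S"
    proof
      assume "\<exists>j\<in>S. i \<in> B j"
      then obtain j where "j \<in> S" "i \<in> B j" by blast
      then show "i \<in> S" using leader_unique[OF i, of j i] self_in_coset[OF lt] S by auto
    next
      assume "i \<in> S"
      then show "\<exists>j\<in>S. i \<in> B j" using self_in_coset[OF lt] by blast
    qed
    finally show ?thesis by simp
  qed
  then show ?thesis using S unfolding leader_roots_def by blast
qed

section \<open>Basic zeros and complementary pairs\<close>

lemma BZ_eq: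
  assumes "cyclic_code n E"
  shows "BZ \<iota> q n \<alpha> L E = (\<lambda>i. \<alpha> ^ i) ` leader_roots (generator_poly n E)"
proof -
  let ?g = "generator_poly n E"
  have "(THE S. S \<subseteq> L \<and> map_poly \<iota> ?g = (\<Prod>i\<in>S. M i)) = leader_roots ?g"
  proof (rule the_equality)
    show "leader_roots ?g \<subseteq> L \<and> map_poly \<iota> ?g = (\<Prod>i\<in>leader_roots ?g. M i)"
      using map_divisor_eq_prod[OF cyclic_code_generator(1,2)[OF n_pos assms]]
      by (simp add: leader_roots_def)
    fix S assume "S \<subseteq> L \<and> map_poly \<iota> ?g = (\<Prod>i\<in>S. M i)"
    then show "S = leader_roots ?g" by (intro prod_coset_min_poly_unique) simp_all
  qed
  then show ?thesis by (simp add: BZ_def)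
qed

text \<open>Complementary index sets multiply to the product over all leaders, which is x^n - 1 over
  the extension; injectivity of \<open>\<iota>\<close> brings the identity down. Conversely, every
  leader gives a root of the product, and coprimality excludes a common root.\<close>

lemma leader_roots_complement_iff:
  assumes g: "monic g" "g dvd cyclic_modulus n" and h: "monic h" "h dvd cyclic_modulus n"
  shows "leader_roots g = L - leader_roots h \<longleftrightarrow> g * h = cyclic_modulus n"
proof
  have root: "poly (cyclic_modulus n) (\<alpha> ^ i) = 0" if "i \<in> L" for i
  proof -
    have "\<alpha> ^ i \<in> (\<lambda>s. \<alpha> ^ s) ` {..<n}" using that leaders_subset by blast
    then show ?thesis unfolding cyclic_modulus_eq_prod poly_prod by (intro prod_zero) auto
  qed
  {
    assume eq: "leader_roots g = L - leader_roots h"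
    have sub: "leader_roots h \<subseteq> L" by (auto simp: leader_roots_def)
    \<comment> \<open>The factorization of divisors is applied to x^n - 1 itself.\<close>
    have "leader_roots (cyclic_modulus n) = L" using root by (auto simp: leader_roots_def map_cyclic_modulus)
    then have "map_poly \<iota> (cyclic_modulus n) = (\<Prod>i\<in>L. M i)"
      using map_divisor_eq_prod[of "cyclic_modulus n"] monic_cyclic_modulus[OF n_pos, where ?'a='a] by simp
    also have "\<dots> = (\<Prod>i\<in>L - leader_roots h. M i) * (\<Prod>i\<in>leader_roots h. M i)"
      by (rule prod.subset_diff[OF sub finite_leaders])
    also have "\<dots> = map_poly \<iota> (g * h)"
      using map_divisor_eq_prod[OF g] map_divisor_eq_prod[OF h] by (simp add: \<iota>P.hom_mult eq)
    finally have "\<iota> (Polynomial.coeff (g * h) k) = \<iota> (Polynomial.coeff (cyclic_modulus n) k)" for k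
      by (metis coeff_map_poly hom_zero)
    then show "g * h = cyclic_modulus n" by (intro poly_eqI) (simp only: eq_iff)
  }
  assume gh: "g * h = cyclic_modulus n"
  have "g \<noteq> 0" using g by auto
  then obtain u v where "u * g + v * h = 1"
    using polynomial_bezout[of g h] cyclic_modulus_factors_coprime[OF of_nat_n_nonzero gh] by blast
  then have "map_poly \<iota> (u * g + v * h) = 1" by simp
  then have bez: "map_poly \<iota> u * map_poly \<iota> g + map_poly \<iota> v * map_poly \<iota> h = 1"
    by (simp only: \<iota>P.hom_add \<iota>P.hom_mult)
  have "poly (map_poly \<iota> g) (\<alpha> ^ i) \<noteq> 0 \<or> poly (map_poly \<iota> h) (\<alpha> ^ i) \<noteq> 0" for i
    using arg_cong[OF bez, of "\<lambda>f. poly f (\<alpha> ^ i)"] by auto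
  moreover have "poly (map_poly \<iota> g) (\<alpha> ^ i) = 0 \<or> poly (map_poly \<iota> h) (\<alpha> ^ i) = 0" if "i \<in> L" for i
  proof -
    have "map_poly \<iota> g * map_poly \<iota> h = cyclic_modulus n"
      using map_cyclic_modulus by (simp flip: \<iota>P.hom_mult gh)
    from arg_cong[OF this, of "\<lambda>f. poly f (\<alpha> ^ i)"] show ?thesis using root[OF that] by simp
  qed
  ultimately show "leader_roots g = L - leader_roots h" by (auto simp: leader_roots_def)
qed

lemma LCP_iff_BZ_dual:
  assumes C: "cyclic_code n C" and D: "cyclic_code n D"
  shows "LCP n C D \<longleftrightarrow>
    BZ \<iota> q n \<alpha> L (dual_code n C) = (\<lambda>i. \<alpha> ^ i) ` L - BZ \<iota> q n \<alpha> L (dual_code n D)"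
proof -
  let ?R = "\<lambda>E. leader_roots (generator_poly n (dual_code n E))"
  note dual = C[THEN cyclic_code_dual] D[THEN cyclic_code_dual]
  note gen = dual[THEN cyclic_code_generator(1)[OF n_pos]] dual[THEN cyclic_code_generator(2)[OF n_pos]]
  have R: "?R E \<subseteq> L" for E by (auto simp: leader_roots_def)
  have inj: "inj_on (\<lambda>i. \<alpha> ^ i) L" by (rule inj_on_subset[OF \<alpha>_inj leaders_subset])
  have "LCP n C D \<longleftrightarrow> ?R C = L - ?R D"
    unfolding LCP_iff_dual_generators[OF of_nat_n_nonzero C D]
    by (rule leader_roots_complement_iff[OF gen(1,3,2,4), symmetric])
  also have "\<dots> \<longleftrightarrow> (\<lambda>i. \<alpha> ^ i) ` ?R C = (\<lambda>i. \<alpha> ^ i) ` (L - ?R D)"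
    using R by (intro inj_on_image_eq_iff[OF inj, symmetric]) auto
  \<comment> \<open>Images commute with this set difference because distinct leaders give distinct
    powers of \<open>\<alpha>\<close>.\<close>
  also have "(\<lambda>i. \<alpha> ^ i) ` (L - ?R D) = (\<lambda>i. \<alpha> ^ i) ` L - (\<lambda>i. \<alpha> ^ i) ` ?R D"
    by (rule inj_on_image_set_diff[OF inj _ R]) auto
  finally show ?thesis by (simp only: BZ_eq[OF dual(1)] BZ_eq[OF dual(2)])
qed

end

theorem theorem6:
  fixes \<iota> :: "'a::{field,finite} \<Rightarrow> 'k::field"
    and \<alpha> :: 'k
    and q m n :: nat
    and C D :: "'a vec set"
    and L :: "nat set"
  assumes "field_hom \<iota>"
    and "q = CARD('a)"
    and "m \<ge> 1"
    and "n = q ^ m - 1"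
    and "primitive_root_of_unity n \<alpha>"
    and "cyclic_code n C"
    and "cyclic_code n D"
    and "coset_leaders q n L"
  shows "LCP n C D \<longleftrightarrow>
    BZ \<iota> q n \<alpha> L (dual_code n C) = (\<lambda>i. \<alpha> ^ i) ` L - BZ \<iota> q n \<alpha> L (dual_code n D)"
proof -
  have "cyclotomic_cosets \<iota> \<alpha> q m n L"
    using assms(1-5,8) by (rule cyclotomic_cosets.intro)
  then show ?thesis using assms(6,7) by (rule cyclotomic_cosets.LCP_iff_BZ_dual)
qed

end
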